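(* Let $n\ge 2$ and let $T_1,\widetilde T_1,\overline T_1$ (invertible, upper-triangular) and $T_2,\widetilde T_2,\overline T_2$ (invertible, lower-triangular) be the $n\times n$ transport matrices of the two triangles of a triangulated square, which satisfy the groupoid path conditions $$\widetilde T_1 S\,\overline T_1 S\,T_1 S=\mathrm{Id},\qquad \widetilde T_2 S\,\overline T_2 S\,T_2 S=\mathrm{Id},$$ where $S=\sum_{i=1}^n(-1)^iE_{i,n+1-i}$. Put $$B=T_2T_1,\qquad \mathbb A=T_1^{-1}S\,\widetilde T_2\,\widetilde T_1^{\mathrm T}S .$$ Then $\mathbb A$ is upper-triangular, and $$\widetilde{\mathbb A}:=B\mathbb AB^{\mathrm T}=S\,\overline T_2^{\,-1}\bigl[\overline T_1^{\,\mathrm T}\bigr]^{-1}S\,T_2^{\mathrm T},$$ and $\widetilde{\mathbb A}$ is upper-triangular as well. That is, $(B,\mathbb A)$ solves the non-normalized symplectic groupoid compatibility condition that both $\mathbb A$ and $B\mathbb AB^{\mathrm T}$ be non-degenerate upper-triangular matrices.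
   Context: $E_{i,j}$ are the standard matrix units and $M^{\mathrm T}$ is the transpose of $M$. A square (disk with four marked boundary points) is cut by a diagonal into a right triangle (index $1$) and a left triangle (index $2$). In each triangle, a point of the moduli space of pinnings (given by Fock–Goncharov–Shen parameters) determines three transport matrices between pairs of sides of the triangle, one around each vertex, denoted $T_k,\widetilde T_k,\overline T_k$ for $k=1,2$. The properties of these matrices that enter the statement are: they are invertible $n\times n$ matrices; those with index $1$ are upper-triangular and those with index $2$ are lower-triangular; and for each triangle the composition of the three transports satisfies the groupoid path condition displayed in the claim. *)

theory Defs
  imports Jordan_Normal_Form.Gauss_Jordan_Elimination
begin

text \<open>
  Matrices in Jordan_Normal_Form are indexed from 0. The matrix
  \<open>S = (\<Sum>i=1..n. (-1)^i E\<^sub>i\<^sub>,\<^sub>n\<^sub>+\<^sub>1\<^sub>-\<^sub>i)\<close> has its 1-based entry \<open>(i, n+1-i)\<close> at the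
  0-based position \<open>(i-1, n-i)\<close>; so the 0-based row \<open>i\<close> carries the sign \<open>(-1)^(i+1)\<close>.
\<close>

definition S_mat :: "nat \<Rightarrow> 'a::field mat" where
  "S_mat n = mat n n (\<lambda>(i, j). if i + j + 1 = n then (-1) ^ (i + 1) else 0)"

definition lower_triangular :: "'a::zero mat \<Rightarrow> bool" where
  "lower_triangular A \<longleftrightarrow> (\<forall>j < dim_col A. \<forall>i < j. A $$ (i, j) = 0)"

text \<open>Total version of \<^const>\<open>mat_inverse\<close>; meaningful for invertible square matrices only.\<close>

definition mat_inv :: "'a::field mat \<Rightarrow> 'a mat" where
  "mat_inv A = the (mat_inverse A)"

definition nondeg_upper_triangular :: "nat \<Rightarrow> 'a::field mat \<Rightarrow> bool" where
  "nondeg_upper_triangular n A \<longleftrightarrow> A \<in> carrier_mat n n \<and> invertible_mat A \<and> upper_triangular A"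

definition nondeg_lower_triangular :: "nat \<Rightarrow> 'a::field mat \<Rightarrow> bool" where
  "nondeg_lower_triangular n A \<longleftrightarrow> A \<in> carrier_mat n n \<and> invertible_mat A \<and> lower_triangular A"

text \<open>
  The compatibility condition of the symplectic groupoid; non-normalized, i.e. the diagonal
  entries of the two triangular matrices are not required to be 1.
\<close>

definition symplectic_groupoid_compatible :: "nat \<Rightarrow> 'a::field mat \<Rightarrow> 'a mat \<Rightarrow> bool" where
  "symplectic_groupoid_compatible n B A \<longleftrightarrow>
     B \<in> carrier_mat n n \<and>
     nondeg_upper_triangular n A \<and>
     nondeg_upper_triangular n (B * A * transpose_mat B)"

end

theory Submission
  imports Defs "Jordan_Normal_Form.Determinant"
begin

(* A path condition is a cyclic word equal to the identity, so it gives
   T_k S Ttilde_k = S Tbar_k^-1 S. Inserting this for k = 2, and its transpose for k = 1, into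
   B A B^T = (T_2 S Ttilde_2) (Ttilde_1^T S T_1^T) T_2^T yields the formula; the signs from
   S^2 = (-1)^(n+1) and S^T = (-1)^(n+1) S cancel in pairs. Both triangularity claims hold because
   conjugation by S turns lower triangular matrices into upper triangular ones. *)

section \<open>Invertibility and inverses of square matrices over a field\<close>

lemma invertible_mat_iff_det:
  fixes A :: "'a::field mat"
  assumes A: "A \<in> carrier_mat n n"
  shows "invertible_mat A \<longleftrightarrow> det A \<noteq> 0"
proof
  assume "invertible_mat A"
  then obtain B where AB: "A * B = 1\<^sub>m n" and BA: "B * A = 1\<^sub>m (dim_row B)"
    using A unfolding invertible_mat_def inverts_mat_def by auto
  \<comment> \<open>\<open>inverts_mat\<close> leaves the dimensions of the witness \<open>B\<close>
    open; the sizes of the two identity matrices force both to be \<open>n\<close>.\<close>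
  have "dim_row B = dim_col (B * A)" "dim_col B = dim_col (A * B)"
    using BA by simp_all
  then have B: "B \<in> carrier_mat n n"
    using A AB by (intro carrier_matI) simp_all
  have "det A * det B = 1"
    using det_mult[OF A B] AB by simp
  then show "det A \<noteq> 0" by auto
next
  assume "det A \<noteq> 0"
  then have "A \<in> Units (ring_mat TYPE('a) n ())"
    by (rule det_non_zero_imp_unit[OF A])
  then show "invertible_mat A"
    using A unfolding Units_def ring_mat_def invertible_mat_def inverts_mat_def by auto
qed

lemma invertible_mat_mult:
  fixes A B :: "'a::field mat"
  assumes "A \<in> carrier_mat n n" "B \<in> carrier_mat n n" "invertible_mat A" "invertible_mat B"
  shows "invertible_mat (A * B)"
  using assms by (simp add: invertible_mat_iff_det[of _ n] det_mult[of _ n])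

lemma invertible_mat_transpose:
  fixes A :: "'a::field mat"
  assumes "A \<in> carrier_mat n n" "invertible_mat A"
  shows "invertible_mat (transpose_mat A)"
  using assms by (simp add: invertible_mat_iff_det[of _ n] det_transpose[of _ n])

text \<open>A unit of the matrix ring rules out the result \<open>None\<close> of
  \<open>mat_inverse\<close>, so \<open>the\<close> in \<open>mat_inv\<close> unpacks a genuine
  two-sided inverse.\<close>

lemma mat_inv:
  fixes A :: "'a::field mat"
  assumes A: "A \<in> carrier_mat n n" and inv: "invertible_mat A"
  shows mat_inv_carrier: "mat_inv A \<in> carrier_mat n n"
    and mat_inv_right: "A * mat_inv A = 1\<^sub>m n"
    and mat_inv_left: "mat_inv A * A = 1\<^sub>m n"
proof -
  have "A \<in> Units (ring_mat TYPE('a) n ())"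
    using det_non_zero_imp_unit[OF A] inv A by (simp add: invertible_mat_iff_det)
  then obtain B where "mat_inverse A = Some B"
    using mat_inverse(1)[OF A, where b = "()"] by (cases "mat_inverse A") auto
  with mat_inverse(2)[OF A this]
  show "mat_inv A \<in> carrier_mat n n" "A * mat_inv A = 1\<^sub>m n" "mat_inv A * A = 1\<^sub>m n"
    by (simp_all add: mat_inv_def)
qed

lemma mat_inv_invertible:
  fixes A :: "'a::field mat"
  assumes "A \<in> carrier_mat n n" "invertible_mat A"
  shows "invertible_mat (mat_inv A)"
  using mat_inv[OF assms] assms(1)
  unfolding invertible_mat_def inverts_mat_def by auto

text \<open>A left inverse of a square matrix over a field is also a right inverse, so
  \<open>A\<close> is invertible; the two groupings of \<open>X * A * mat_inv A\<close> then give
  the equality.\<close>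

lemma mat_inv_unique:
  fixes A X :: "'a::field mat"
  assumes A: "A \<in> carrier_mat n n" and X: "X \<in> carrier_mat n n" and XA: "X * A = 1\<^sub>m n"
  shows "X = mat_inv A"
proof -
  have "A * X = 1\<^sub>m n"
    by (rule mat_mult_left_right_inverse[OF X A XA])
  then have inv: "invertible_mat A"
    using A X XA unfolding invertible_mat_def inverts_mat_def by auto
  note I = mat_inv[OF A inv]
  have "X * (A * mat_inv A) = X * A * mat_inv A"
    using A X I(1) by simp
  then show ?thesis
    using X I XA by simp
qed

lemma mat_inv_transpose:
  fixes A :: "'a::field mat"
  assumes A: "A \<in> carrier_mat n n" and inv: "invertible_mat A"
  shows "mat_inv (transpose_mat A) = transpose_mat (mat_inv A)"
proof -
  note I = mat_inv[OF A inv]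
  have "transpose_mat (mat_inv A) * transpose_mat A = 1\<^sub>m n"
    using transpose_mult[OF A I(1)] I(2) by simp
  then show ?thesis
    by (intro mat_inv_unique[symmetric]) (use A I(1) in simp_all)
qed

section \<open>Triangular matrices: transposes, products and inverses\<close>

lemma lower_triangular_transpose:
  "A \<in> carrier_mat n n \<Longrightarrow> lower_triangular (transpose_mat A) \<longleftrightarrow> upper_triangular A"
  by (auto simp: lower_triangular_def upper_triangular_def)

lemma upper_triangular_transpose:
  "A \<in> carrier_mat n n \<Longrightarrow> upper_triangular (transpose_mat A) \<longleftrightarrow> lower_triangular A"
  by (auto simp: lower_triangular_def upper_triangular_def)

lemma upper_triangular_mult:
  fixes A B :: "'a::field mat"
  assumes A: "A \<in> carrier_mat n n" and B: "B \<in> carrier_mat n n"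
    and uA: "upper_triangular A" and uB: "upper_triangular B"
  shows "upper_triangular (A * B)"
proof (rule upper_triangularI)
  fix i j assume ji: "j < i" and "i < dim_row (A * B)"
  then have i: "i < n" using A by simp
  \<comment> \<open>For \<open>k < i\<close> the first factor lies below the diagonal of
    \<open>A\<close>; otherwise \<open>j < k\<close>, and the second lies below the diagonal of
    \<open>B\<close>.\<close>
  have "A $$ (i, k) * B $$ (k, j) = 0" if "k < n" for k
    using that i ji A B upper_triangularD[OF uA, of k i] upper_triangularD[OF uB, of j k]
    by (cases "k < i") auto
  then show "(A * B) $$ (i, j) = 0"
    using A B i ji by (auto simp: scalar_prod_def intro!: sum.neutral)
qed

lemma lower_triangular_mult:
  fixes A B :: "'a::field mat"
  assumes A: "A \<in> carrier_mat n n" and B: "B \<in> carrier_mat n n"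
    and lA: "lower_triangular A" and lB: "lower_triangular B"
  shows "lower_triangular (A * B)"
  using upper_triangular_mult[of "transpose_mat B" n "transpose_mat A"] assms
  by (simp add: transpose_mult[OF A B, symmetric] upper_triangular_transpose[of _ n])

text \<open>Induction on the column \<open>j\<close>. In entry \<open>(i, j)\<close> of
  \<open>mat_inv A * A\<close>, the terms with \<open>k < j\<close> vanish by the induction
  hypothesis and those with \<open>k > j\<close> by triangularity of \<open>A\<close>. What remains
  is \<open>mat_inv A $$ (i, j) * A $$ (j, j) = 0\<close>, and the diagonal of \<open>A\<close> has
  no zero because its product is the determinant.\<close>

lemma upper_triangular_mat_inv:
  fixes A :: "'a::field mat"
  assumes A: "A \<in> carrier_mat n n" and inv: "invertible_mat A" and uA: "upper_triangular A"
  shows "upper_triangular (mat_inv A)"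
proof (rule upper_triangularI)
  note I = mat_inv[OF A inv]
  have diag: "A $$ (j, j) \<noteq> 0" if "j < n" for j
    using that inv A upper_triangular_imp_det_eq_0_iff[OF A uA]
    by (force simp: invertible_mat_iff_det diag_mat_def)
  have "mat_inv A $$ (i, j) = 0" if "i < n" "j < i" for i j
    using that(2)
  proof (induction j rule: less_induct)
    case (less j)
    have "mat_inv A $$ (i, k) * A $$ (k, j) = 0" if "k \<in> {0..<n} - {j}" for k
      using that less \<open>i < n\<close> A upper_triangularD[OF uA, of j k] by (cases "k < j") auto
    then have "(\<Sum>k\<in>{0..<n} - {j}. mat_inv A $$ (i, k) * A $$ (k, j)) = 0"
      by (rule sum.neutral[OF ballI])
    then have "(\<Sum>k\<in>{0..<n}. mat_inv A $$ (i, k) * A $$ (k, j)) = mat_inv A $$ (i, j) * A $$ (j, j)"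
      using less.prems \<open>i < n\<close> by (subst sum.remove[of _ j]) auto
    moreover have "(\<Sum>k\<in>{0..<n}. mat_inv A $$ (i, k) * A $$ (k, j)) = (mat_inv A * A) $$ (i, j)"
      using A I(1) less.prems \<open>i < n\<close> by (auto simp: scalar_prod_def)
    moreover have "(mat_inv A * A) $$ (i, j) = 0"
      using I(3) less.prems \<open>i < n\<close> by simp
    ultimately show ?case
      using diag[of j] less.prems \<open>i < n\<close> by simp
  qed
  then show "j < i \<Longrightarrow> i < dim_row (mat_inv A) \<Longrightarrow> mat_inv A $$ (i, j) = 0" for i j
    using I(1) by simp
qed

lemma lower_triangular_mat_inv:
  fixes A :: "'a::field mat"
  assumes A: "A \<in> carrier_mat n n" and inv: "invertible_mat A" and lA: "lower_triangular A"
  shows "lower_triangular (mat_inv A)"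
  using upper_triangular_mat_inv[of "transpose_mat A" n] invertible_mat_transpose[OF A inv] A lA
  by (simp add: mat_inv_transpose[OF A inv] mat_inv_carrier[OF A inv] upper_triangular_transpose[of _ n])

text \<open>\<open>- ((-1) ^ k)\<close> is the simplifier's form of \<open>(-1) ^ (k + 1)\<close>,
  so this rule cancels pairs of the signs that \<open>S_mat\<close> produces.\<close>

lemma sign_smult_twice: "- ((-1) ^ k) \<cdot>\<^sub>m (- ((-1) ^ k) \<cdot>\<^sub>m M) = (M :: 'a::comm_ring_1 mat)"
  by (rule eq_matI) (simp_all add: mult.assoc[symmetric] power_mult_distrib[symmetric])

section \<open>The signed antidiagonal matrix and conjugation by it\<close>

lemma S_mat_carrier [simp]: "S_mat n \<in> carrier_mat n n"
  by (simp add: S_mat_def)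

text \<open>The sign of an antidiagonal entry depends on its row, and transposition exchanges rows
  \<open>i\<close> and \<open>n - 1 - i\<close>. Their sign exponents \<open>i + 1\<close> and
  \<open>n - i\<close> add up to \<open>n + 1\<close>, so the two signs differ by the constant
  factor \<open>(-1) ^ (n + 1)\<close>.\<close>

lemma transpose_S_mat: "transpose_mat (S_mat n) = (-1) ^ (n + 1) \<cdot>\<^sub>m (S_mat n :: 'a::field mat)"
proof (rule eq_matI)
  fix i j assume "i < dim_row ((-1) ^ (n + 1) \<cdot>\<^sub>m (S_mat n :: 'a mat))"
    and "j < dim_col ((-1) ^ (n + 1) \<cdot>\<^sub>m (S_mat n :: 'a mat))"
  then have "i < n" "j < n" by (simp_all add: S_mat_def)
  moreover have "(-1 :: 'a) ^ (j + 1) = (-1) ^ (n + 1) * (-1) ^ (i + 1)" if "i + j + 1 = n"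
  proof -
    have "n + 1 + (i + 1) = 2 * (i + 1) + (j + 1)" using that by simp
    then show ?thesis by (simp only: power_add [symmetric]) (simp add: power_add)
  qed
  ultimately show "transpose_mat (S_mat n) $$ (i, j) = ((-1) ^ (n + 1) \<cdot>\<^sub>m (S_mat n :: 'a mat)) $$ (i, j)"
    by (simp add: S_mat_def add.commute)
qed (simp_all add: S_mat_def)

lemma S_mat_mult_index:
  fixes M :: "'a::field mat"
  assumes M: "M \<in> carrier_mat n n" and ij: "i < n" "j < n"
  shows "(S_mat n * M) $$ (i, j) = (-1) ^ (i + 1) * M $$ (n - 1 - i, j)"
proof -
  have "(S_mat n * M) $$ (i, j) = (\<Sum>k\<in>{0..<n}. S_mat n $$ (i, k) * M $$ (k, j))"
    using assms by (simp add: S_mat_def scalar_prod_def)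
  also have "\<dots> = (\<Sum>k\<in>{0..<n}. if n - 1 - i = k then (-1) ^ (i + 1) * M $$ (k, j) else 0)"
    using assms by (intro sum.cong) (auto simp: S_mat_def)
  also have "\<dots> = (-1) ^ (i + 1) * M $$ (n - 1 - i, j)"
    using ij by (subst sum.delta') auto
  finally show ?thesis .
qed

lemma S_mat_square: "S_mat n * S_mat n = (-1) ^ (n + 1) \<cdot>\<^sub>m (1\<^sub>m n :: 'a::field mat)"
proof (rule eq_matI)
  fix i j assume "i < dim_row ((-1) ^ (n + 1) \<cdot>\<^sub>m (1\<^sub>m n :: 'a mat))"
    and "j < dim_col ((-1) ^ (n + 1) \<cdot>\<^sub>m (1\<^sub>m n :: 'a mat))"
  then have ij: "i < n" "j < n" by simp_all
  \<comment> \<open>The exponents of the two rows involved have the sum \<open>n + 1\<close>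
    whatever \<open>i\<close> is, which makes the square a scalar matrix.\<close>
  then have "(-1 :: 'a) ^ (i + 1) * (-1) ^ (n - 1 - i + 1) = (-1) ^ (n + 1)"
    by (simp only: power_add [symmetric]) simp
  moreover have "(n - 1 - i) + j + 1 = n \<longleftrightarrow> i = j" using ij by auto
  ultimately show "(S_mat n * S_mat n) $$ (i, j) = ((-1) ^ (n + 1) \<cdot>\<^sub>m (1\<^sub>m n :: 'a mat)) $$ (i, j)"
    using ij by (subst S_mat_mult_index) (auto simp: S_mat_def)
qed (simp_all add: S_mat_def)

text \<open>Column \<open>j\<close> of \<open>S_mat n\<close> is nonzero only in row
  \<open>n - 1 - j\<close>, whose sign exponent \<open>(n - 1 - j) + 1\<close> equals
  \<open>n - j\<close>.\<close>

lemma mult_S_mat_index: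
  fixes M :: "'a::field mat"
  assumes M: "M \<in> carrier_mat n n" and ij: "i < n" "j < n"
  shows "(M * S_mat n) $$ (i, j) = M $$ (i, n - 1 - j) * (-1) ^ (n - j)"
proof -
  have "(M * S_mat n) $$ (i, j) = (\<Sum>k\<in>{0..<n}. M $$ (i, k) * S_mat n $$ (k, j))"
    using assms by (simp add: S_mat_def scalar_prod_def)
  also have "\<dots> = (\<Sum>k\<in>{0..<n}. if n - 1 - j = k then M $$ (i, k) * (-1) ^ (n - j) else 0)"
    using assms by (intro sum.cong) (auto simp: S_mat_def)
  also have "\<dots> = M $$ (i, n - 1 - j) * (-1) ^ (n - j)"
    using ij by (subst sum.delta') auto
  finally show ?thesis .
qed

text \<open>Up to sign, entry \<open>(i, j)\<close> of the product is entry
  \<open>(n - 1 - i, n - 1 - j)\<close> of \<open>L\<close>; reversing both indices moves positions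
  below the diagonal above it.\<close>

lemma upper_triangular_S_conj:
  fixes L :: "'a::field mat"
  assumes L: "L \<in> carrier_mat n n" and low: "lower_triangular L"
  shows "upper_triangular (S_mat n * L * S_mat n)"
proof (rule upper_triangularI)
  fix i j assume ji: "j < i" and "i < dim_row (S_mat n * L * S_mat n)"
  then have i: "i < n" by (simp add: S_mat_def)
  have SL: "S_mat n * L \<in> carrier_mat n n" by (rule mult_carrier_mat[OF S_mat_carrier L])
  have "L $$ (n - 1 - i, n - 1 - j) = 0"
    using low L ji i by (auto simp: lower_triangular_def)
  then show "(S_mat n * L * S_mat n) $$ (i, j) = 0"
    using ji i by (simp add: mult_S_mat_index[OF SL] S_mat_mult_index[OF L])
qed

lemma invertible_S_mat: "invertible_mat (S_mat n :: 'a::field mat)"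
proof -
  \<comment> \<open>The determinant itself is not computed: its square is the determinant of a
    nonzero scalar matrix.\<close>
  have "det (S_mat n :: 'a mat) * det (S_mat n :: 'a mat) = ((-1) ^ (n + 1)) ^ n"
    using det_mult[of "S_mat n :: 'a mat" n "S_mat n"] by (simp add: S_mat_square det_smult)
  then have "det (S_mat n :: 'a mat) \<noteq> 0" by auto
  then show ?thesis by (simp add: invertible_mat_iff_det[of _ n])
qed

text \<open>The trailing factor \<open>M\<close> lets the square be rewritten inside right-nested
  products, the form that \<open>assoc_mult_mat\<close> produces.\<close>

lemma S_mat_cancel:
  fixes M :: "'a::field mat"
  assumes M: "M \<in> carrier_mat n m"
  shows "S_mat n * (S_mat n * M) = (-1) ^ (n + 1) \<cdot>\<^sub>m M"
proof -
  have "S_mat n * (S_mat n * M) = (S_mat n * S_mat n) * M"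
    using M by (simp add: assoc_mult_mat[of _ n n _ n _ m])
  then show ?thesis
    using M by (simp add: S_mat_square mult_smult_assoc_mat[of _ n n _ m])
qed

text \<open>Grouped as \<open>(X S Y) (S Z S) = 1\<close>, the word may be rotated, since one-sided
  inverses are two-sided. Hence \<open>S Z S X S\<close> is a left inverse of \<open>Y\<close>.
  Multiplying it by \<open>S\<close> on both sides creates two squares of \<open>S\<close>, whose
  signs cancel.\<close>

lemma path_cycle:
  fixes X Y Z :: "'a::field mat"
  assumes X: "X \<in> carrier_mat n n" and Y: "Y \<in> carrier_mat n n" and Z: "Z \<in> carrier_mat n n"
    and path: "X * S_mat n * Y * S_mat n * Z * S_mat n = 1\<^sub>m n"
  shows "Z * S_mat n * X = S_mat n * mat_inv Y * S_mat n"
proof -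
  let ?S = "S_mat n :: 'a mat" and ?c = "(-1 :: 'a) ^ (n + 1)"
  note assoc = assoc_mult_mat[of _ n n _ n _ n] mult_carrier_mat[of _ n n _ n]
  have "(X * ?S * Y) * (?S * Z * ?S) = 1\<^sub>m n"
    using path X Y Z by (simp add: assoc)
  then have "(?S * Z * ?S) * (X * ?S * Y) = 1\<^sub>m n"
    by (rule mat_mult_left_right_inverse[rotated 2]) (use X Y Z in \<open>simp_all add: assoc\<close>)
  then have "?S * (Z * (?S * (X * ?S))) * Y = 1\<^sub>m n"
    using X Y Z by (simp add: assoc)
  then have "mat_inv Y = ?S * (Z * (?S * (X * ?S)))"
    by (intro mat_inv_unique[OF Y, symmetric]) (use X Z in \<open>simp_all add: assoc\<close>)
  then have "?S * mat_inv Y * ?S = ?S * (?S * (Z * (?S * (X * (?S * ?S)))))"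
    using X Z by (simp add: assoc)
  also have "\<dots> = ?c \<cdot>\<^sub>m (?c \<cdot>\<^sub>m (Z * (?S * X)))"
    using X Z by (simp add: assoc S_mat_cancel[of _ n n] S_mat_square mult_smult_distrib[of _ n n _ n])
  also have "\<dots> = Z * ?S * X"
    using X Z by (simp add: assoc sign_smult_twice)
  finally show ?thesis by simp
qed

section \<open>The two triangles glued into a square\<close>

theorem theorem2p1:
  fixes n :: nat
    and T1 Ttilde1 Tbar1 T2 Ttilde2 Tbar2 S B A :: "'a::field mat"
  assumes n: "n \<ge> 2"
    and S: "S = S_mat n"
    and T1: "nondeg_upper_triangular n T1"
    and Ttilde1: "nondeg_upper_triangular n Ttilde1"
    and Tbar1: "nondeg_upper_triangular n Tbar1"
    and T2: "nondeg_lower_triangular n T2"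
    and Ttilde2: "nondeg_lower_triangular n Ttilde2"
    and Tbar2: "nondeg_lower_triangular n Tbar2"
    and path1: "Ttilde1 * S * Tbar1 * S * T1 * S = 1\<^sub>m n"
    and path2: "Ttilde2 * S * Tbar2 * S * T2 * S = 1\<^sub>m n"
    and B: "B = T2 * T1"
    and A: "A = mat_inv T1 * S * Ttilde2 * transpose_mat Ttilde1 * S"
  shows "upper_triangular A
    \<and> B * A * transpose_mat B
        = S * mat_inv Tbar2 * mat_inv (transpose_mat Tbar1) * S * transpose_mat T2
    \<and> upper_triangular (B * A * transpose_mat B)
    \<and> symplectic_groupoid_compatible n B A"
proof -
  let ?c = "(-1 :: 'a) ^ (n + 1)"
  note assoc = assoc_mult_mat[of _ n n _ n _ n] mult_carrier_mat[of _ n n _ n]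
  note tri = nondeg_upper_triangular_def nondeg_lower_triangular_def
  have carr [simp]: "T1 \<in> carrier_mat n n" "Ttilde1 \<in> carrier_mat n n" "Tbar1 \<in> carrier_mat n n"
      "T2 \<in> carrier_mat n n" "Ttilde2 \<in> carrier_mat n n" "Tbar2 \<in> carrier_mat n n"
      "S \<in> carrier_mat n n"
    and inv: "invertible_mat T1" "invertible_mat Ttilde1" "invertible_mat Tbar1"
      "invertible_mat T2" "invertible_mat Ttilde2" "invertible_mat Tbar2" "invertible_mat S"
    using T1 Ttilde1 Tbar1 T2 Ttilde2 Tbar2 by (simp_all add: tri S invertible_S_mat)
  have carr_inv [simp]: "mat_inv T1 \<in> carrier_mat n n" "mat_inv Tbar1 \<in> carrier_mat n n"
      "mat_inv Tbar2 \<in> carrier_mat n n"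
    using inv by (simp_all add: mat_inv_carrier[of _ n])
  have A_carrier: "A \<in> carrier_mat n n" and B_carrier: "B \<in> carrier_mat n n"
    by (auto simp: A B intro!: mult_carrier_mat[of _ n n _ n])
  \<comment> \<open>This grouping shows \<open>A\<close> as an upper triangular inverse times the
    conjugate by \<open>S\<close> of a product of two lower triangular matrices.\<close>
  have A_eq: "A = mat_inv T1 * (S * (Ttilde2 * transpose_mat Ttilde1) * S)"
    by (simp add: A assoc)
  have "lower_triangular (Ttilde2 * transpose_mat Ttilde1)"
    by (rule lower_triangular_mult[of _ n])
      (use Ttilde1 Ttilde2 in \<open>auto simp: tri lower_triangular_transpose[of _ n]\<close>)
  then have "upper_triangular (S * (Ttilde2 * transpose_mat Ttilde1) * S)"
    unfolding S by (intro upper_triangular_S_conj) (simp_all add: assoc)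
  moreover have "upper_triangular (mat_inv T1)"
    by (rule upper_triangular_mat_inv[of _ n]) (use T1 in \<open>simp_all add: tri\<close>)
  ultimately have upper_A: "upper_triangular A"
    unfolding A_eq by (intro upper_triangular_mult[of "mat_inv T1" n]) (simp_all add: assoc)
  have inv_A: "invertible_mat A"
    unfolding A using inv
    by (intro invertible_mat_mult[of _ n] mat_inv_invertible[of _ n] invertible_mat_transpose[of _ n])
      (simp_all add: assoc)
  have inv_B: "invertible_mat B"
    unfolding B using inv by (intro invertible_mat_mult[of _ n]) auto

  have cycle1: "T1 * S * Ttilde1 = S * mat_inv Tbar1 * S"
    unfolding S by (rule path_cycle) (use path1 S in simp_all)
  have cycle2: "T2 * S * Ttilde2 = S * mat_inv Tbar2 * S"
    unfolding S by (rule path_cycle) (use path2 S in simp_all)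
  have transpose_S: "transpose_mat S = ?c \<cdot>\<^sub>m S"
    unfolding S by (rule transpose_S_mat)
  have "transpose_mat Ttilde1 * (transpose_mat S * transpose_mat T1)
      = transpose_mat S * (transpose_mat (mat_inv Tbar1) * transpose_mat S)"
    using arg_cong[OF cycle1, of transpose_mat]
    by (simp add: transpose_mult[of _ n n _ n] assoc)
  then have "?c \<cdot>\<^sub>m (transpose_mat Ttilde1 * (S * transpose_mat T1))
      = ?c \<cdot>\<^sub>m (?c \<cdot>\<^sub>m (S * (transpose_mat (mat_inv Tbar1) * S)))"
    by (simp add: transpose_S assoc mult_smult_distrib[of _ n n _ n] mult_smult_assoc_mat[of _ n n _ n])
  \<comment> \<open>Transposing \<open>cycle1\<close> left one sign on the left and two on the
    right. One more factor \<open>?c\<close> makes the left signs cancel and leaves a single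
    \<open>?c\<close> on the right.\<close>
  then have "?c \<cdot>\<^sub>m (?c \<cdot>\<^sub>m (transpose_mat Ttilde1 * (S * transpose_mat T1)))
      = ?c \<cdot>\<^sub>m (?c \<cdot>\<^sub>m (?c \<cdot>\<^sub>m (S * (transpose_mat (mat_inv Tbar1) * S))))"
    by (rule arg_cong)
  then have cycle1T: "transpose_mat Ttilde1 * (S * transpose_mat T1)
      = ?c \<cdot>\<^sub>m (S * (transpose_mat (mat_inv Tbar1) * S))"
    by (simp add: sign_smult_twice)

  have "B * A * transpose_mat B
      = T2 * (T1 * mat_inv T1 * (S * (Ttilde2 * (transpose_mat Ttilde1 * (S * (transpose_mat T1 * transpose_mat T2))))))"
    by (simp add: A B transpose_mult[of _ n n _ n] assoc)
  \<comment> \<open>With \<open>T1 * mat_inv T1\<close> gone, the word splits into the left-hand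
    sides of \<open>cycle2\<close> and \<open>cycle1T\<close>, one for each triangle.\<close>
  also have "\<dots> = (T2 * S * Ttilde2) * (transpose_mat Ttilde1 * (S * transpose_mat T1)) * transpose_mat T2"
    by (simp add: mat_inv_right[OF _ inv(1), of n] left_mult_one_mat[of _ n n] assoc)
  also have "\<dots> = ?c \<cdot>\<^sub>m (S * (mat_inv Tbar2 * (S * (S * (transpose_mat (mat_inv Tbar1) * (S * transpose_mat T2))))))"
    by (simp add: cycle1T cycle2 assoc mult_smult_distrib[of _ n n _ n] mult_smult_assoc_mat[of _ n n _ n])
  \<comment> \<open>The adjacent pair \<open>S * S\<close> where the two words meet contributes the
    sign that cancels the \<open>?c\<close> of \<open>cycle1T\<close>.\<close>
  also have "\<dots> = S * mat_inv Tbar2 * transpose_mat (mat_inv Tbar1) * S * transpose_mat T2"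
    by (simp add: S S_mat_cancel[of _ n n] assoc mult_smult_distrib[of _ n n _ n]
        sign_smult_twice)
  finally have BAB_S: "B * A * transpose_mat B
      = S * mat_inv Tbar2 * transpose_mat (mat_inv Tbar1) * S * transpose_mat T2" .
  \<comment> \<open>The claimed formula inverts the transpose; \<open>BAB_S\<close> keeps the
    transpose of the inverse, whose triangularity follows directly from that of
    \<open>Tbar1\<close>.\<close>
  then have BAB: "B * A * transpose_mat B
      = S * mat_inv Tbar2 * mat_inv (transpose_mat Tbar1) * S * transpose_mat T2"
    by (simp add: mat_inv_transpose[OF _ inv(3), of n])
  have "lower_triangular (mat_inv Tbar2)"
    by (rule lower_triangular_mat_inv[of _ n]) (use Tbar2 in \<open>simp_all add: tri\<close>)
  moreover have "upper_triangular (mat_inv Tbar1)"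
    by (rule upper_triangular_mat_inv[of _ n]) (use Tbar1 in \<open>simp_all add: tri\<close>)
  \<comment> \<open>As for \<open>A\<close>, the product between the two copies of \<open>S\<close>
    is lower triangular; the remaining factor \<open>transpose_mat T2\<close> is upper
    triangular.\<close>
  ultimately have "lower_triangular (mat_inv Tbar2 * transpose_mat (mat_inv Tbar1))"
    by (intro lower_triangular_mult[of "mat_inv Tbar2" n]) (simp_all add: lower_triangular_transpose[of _ n])
  then have "upper_triangular (S * (mat_inv Tbar2 * transpose_mat (mat_inv Tbar1)) * S)"
    unfolding S by (intro upper_triangular_S_conj) (simp_all add: assoc)
  moreover have "upper_triangular (transpose_mat T2)"
    using T2 by (simp add: tri upper_triangular_transpose[of _ n])
  ultimately have
    "upper_triangular (S * (mat_inv Tbar2 * transpose_mat (mat_inv Tbar1)) * S * transpose_mat T2)"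
    by (intro upper_triangular_mult[of _ n "transpose_mat T2"]) (simp_all add: assoc)
  then have upper_BAB: "upper_triangular (B * A * transpose_mat B)"
    by (simp add: BAB_S assoc)
  have "invertible_mat (B * A * transpose_mat B)"
    using A_carrier B_carrier inv_A inv_B
    by (intro invertible_mat_mult[of _ n] invertible_mat_transpose[of _ n]) auto
  then have "symplectic_groupoid_compatible n B A"
    using A_carrier B_carrier inv_A upper_A upper_BAB
    by (simp add: symplectic_groupoid_compatible_def tri)
  with upper_A BAB upper_BAB show ?thesis by blast
qed

end
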